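(* Let $r\in Sl(G)$, let $e_r$ be the idempotent $2$-cocycle associated to $r$, let $H=H(e_r)$ and $$N_1(e_r)=\{\sigma\in G: u_{\sigma}\in \mathrm{rad}(A_{e_r})\ \text{and}\ u_{\sigma}\notin \mathrm{rad}(A_{e_r})^2\}.$$ Then, for an element $a\in N_1(e_r)$, the function $r'_a:G\to\mathbb{N}$ defined by $$r'_a(\sigma)=\begin{cases} r(\sigma), & \text{if } \sigma\notin HaH,\\ r(\sigma)+1, & \text{if } \sigma\in HaH,\end{cases}$$ is an element of $Sl(G)$ with $M_{r'_a}=H$.
   Context: Standing assumptions: $R$ is a complete discrete valuation ring with quotient field $K$, and $L$ is a finite Galois extension of $K$ with Galois group $G$; the extension $L/K$ is unramified with finite residue field. For $\sigma\in G$ and $l\in L$ write $l^\sigma=\sigma(l)$. $Sl(G)$ is the set of all functions $r:G\to\mathbb{N}$ (with $0\in\mathbb{N}$) satisfying $r(1)=0$ and $r(\sigma\tau)\leq r(\sigma)+r(\tau)$ for all $\sigma,\tau\in G$. For $r\in Sl(G)$, $M_r=\{\sigma\in G: r(\sigma)=0\}$, which is known to be a subgroup of $G$. For $r\in Sl(G)$ the function $e_r:G\times G\to\{0,1\}\subseteq L$ is defined by $e_r(\sigma,\tau)=1$ if $r(\sigma\tau)=r(\sigma)+r(\tau)$ and $e_r(\sigma,\tau)=0$ if $r(\sigma\tau)<r(\sigma)+r(\tau)$. It is known to be an idempotent normalized weak $2$-cocycle of $G$ on $L$, i.e. it takes values in $\{0,1\}$, satisfies $e_r(\sigma,\tau)e_r(\sigma\tau,\rho)=e_r(\tau,\rho)^{\sigma}e_r(\sigma,\tau\rho)$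 and $e_r(1,\sigma)=e_r(\sigma,1)=1$. Its inertial group is $H(e_r)=\{\sigma\in G: e_r(\sigma,\sigma^{-1})\neq 0\}$, a subgroup of $G$. $A_{e_r}=\bigoplus_{\sigma\in G}Lu_\sigma$ is the associated weak crossed product $K$-algebra: the $L$-vector space with basis $u_\sigma$, $\sigma\in G$, and multiplication determined by $u_\sigma l=l^{\sigma}u_\sigma$ and $u_\sigma u_\tau=e_r(\sigma,\tau)u_{\sigma\tau}$ for $\sigma,\tau\in G$, $l\in L$. $\mathrm{rad}$ denotes the Jacobson radical. *)

theory Defs
  imports "HOL-Algebra.Algebra" "HOL-Algebra.Finite_Extensions" "HOL-Algebra.Ideal_Product"
begin

text \<open>
  Throughout, \<open>L\<close> is a field and its subrings are represented by carrier sets; the ring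
  belonging to a carrier set \<open>S\<close> is \<open>L\<lparr>carrier := S\<rparr>\<close>.
\<close>

definition discrete_valuation_ring :: "('a, 'b) ring_scheme \<Rightarrow> bool"
  where "discrete_valuation_ring R \<longleftrightarrow>
    principal_domain R \<and> (\<exists>!P. primeideal P R \<and> P \<noteq> {\<zero>\<^bsub>R\<^esub>})"

text \<open>Only meaningful for local rings.\<close>

definition max_ideal :: "('a, 'b) ring_scheme \<Rightarrow> 'a set"
  where "max_ideal R = (THE M. maximalideal M R)"

definition ideal_power :: "('a, 'b) ring_scheme \<Rightarrow> 'a set \<Rightarrow> nat \<Rightarrow> 'a set"
  where "ideal_power R I n = (ideal_prod R I ^^ n) (carrier R)"

text \<open>
  Every Cauchy sequence for the adic topology of the maximal ideal converges. Limits in a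
  discrete valuation ring are automatically unique.
\<close>

definition adically_complete :: "('a, 'b) ring_scheme \<Rightarrow> bool"
  where "adically_complete R \<longleftrightarrow>
    (\<forall>x :: nat \<Rightarrow> 'a.
       range x \<subseteq> carrier R \<and>
       (\<forall>n. \<exists>N. \<forall>i\<ge>N. \<forall>j\<ge>N. x i \<ominus>\<^bsub>R\<^esub> x j \<in> ideal_power R (max_ideal R) n) \<longrightarrow>
       (\<exists>l\<in>carrier R. \<forall>n. \<exists>N. \<forall>i\<ge>N. x i \<ominus>\<^bsub>R\<^esub> l \<in> ideal_power R (max_ideal R) n))"

definition is_quotient_field :: "('a, 'b) ring_scheme \<Rightarrow> 'a set \<Rightarrow> 'a set \<Rightarrow> bool"
  where "is_quotient_field L R K \<longleftrightarrow>
    subfield K L \<and> K = {x \<otimes>\<^bsub>L\<^esub> inv\<^bsub>L\<^esub> y | x y. x \<in> R \<and> y \<in> R - {\<zero>\<^bsub>L\<^esub>}}"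

text \<open>
  Automorphisms are taken extensional outside \<open>carrier L\<close>, so that distinct group elements
  are distinct as maps on \<open>L\<close>. The product \<open>\<sigma>\<tau>\<close> is \<open>x \<mapsto> \<sigma> (\<tau> x)\<close>.
\<close>

definition Gal :: "('a, 'b) ring_scheme \<Rightarrow> 'a set \<Rightarrow> ('a \<Rightarrow> 'a) monoid"
  where "Gal L K = (BijGroup (carrier L))
    \<lparr>carrier := {\<sigma> \<in> ring_iso L L \<inter> extensional (carrier L). \<forall>x\<in>K. \<sigma> x = x}\<rparr>"

definition finite_galois_extension :: "('a, 'b) ring_scheme \<Rightarrow> 'a set \<Rightarrow> bool"
  where "finite_galois_extension L K \<longleftrightarrow>
    field L \<and> subfield K L \<and> ring.finite_dimension L K (carrier L) \<and>
    {x \<in> carrier L. \<forall>\<sigma>\<in>carrier (Gal L K). \<sigma> x = x} = K"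

definition integral_closure :: "('a, 'b) ring_scheme \<Rightarrow> 'a set \<Rightarrow> 'a set"
  where "integral_closure L R = {x \<in> carrier L.
    \<exists>p. p \<noteq> [] \<and> set p \<subseteq> R \<and> lead_coeff p = \<one>\<^bsub>L\<^esub> \<and> ring.eval L p x = \<zero>\<^bsub>L\<^esub>}"

text \<open>An algebraic element is separable if it is a simple root of its minimal polynomial.\<close>

definition separable_extension :: "('a, 'b) ring_scheme \<Rightarrow> 'a set \<Rightarrow> bool"
  where "separable_extension F k \<longleftrightarrow>
    (\<forall>x\<in>carrier F. ring.algebraic F k x \<and> ring.alg_mult F (ring.Irr F k x) x = 1)"

abbreviation residue_field :: "('a, 'b) ring_scheme \<Rightarrow> 'a set ring"
  where "residue_field R \<equiv> R Quot max_ideal R"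

text \<open>
  Ramification index one (the maximal ideal of \<open>R\<close> generates that of the valuation ring
  \<open>S\<close> of \<open>L\<close>) and separable residue extension. The residue field of \<open>R\<close> enters as its
  image in the residue field of \<open>S\<close>.
\<close>

definition unramified :: "('a, 'b) ring_scheme \<Rightarrow> 'a set \<Rightarrow> bool"
  where "unramified L R \<longleftrightarrow>
    (let S = L\<lparr>carrier := integral_closure L R\<rparr>;
         M = max_ideal (L\<lparr>carrier := R\<rparr>);
         N = genideal S M
     in maximalideal N S \<and>
        separable_extension (S Quot N) {N +>\<^bsub>S\<^esub> x | x. x \<in> R})"

text \<open>Only the values on \<open>carrier G\<close> matter.\<close>

definition Sl :: "('g, 'c) monoid_scheme \<Rightarrow> ('g \<Rightarrow> nat) set"
  where "Sl G = {r. r \<one>\<^bsub>G\<^esub> = 0 \<and>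
    (\<forall>\<sigma>\<in>carrier G. \<forall>\<tau>\<in>carrier G. r (\<sigma> \<otimes>\<^bsub>G\<^esub> \<tau>) \<le> r \<sigma> + r \<tau>)}"

definition zero_subgroup :: "('g, 'c) monoid_scheme \<Rightarrow> ('g \<Rightarrow> nat) \<Rightarrow> 'g set"
  where "zero_subgroup G r = {\<sigma> \<in> carrier G. r \<sigma> = 0}"

definition idem_cocycle ::
    "('a, 'b) ring_scheme \<Rightarrow> ('g, 'c) monoid_scheme \<Rightarrow> ('g \<Rightarrow> nat) \<Rightarrow> 'g \<Rightarrow> 'g \<Rightarrow> 'a"
  where "idem_cocycle L G r \<sigma> \<tau> =
    (if r (\<sigma> \<otimes>\<^bsub>G\<^esub> \<tau>) = r \<sigma> + r \<tau> then \<one>\<^bsub>L\<^esub> else \<zero>\<^bsub>L\<^esub>)"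

definition inertial_group ::
    "('a, 'b) ring_scheme \<Rightarrow> ('g, 'c) monoid_scheme \<Rightarrow> ('g \<Rightarrow> 'g \<Rightarrow> 'a) \<Rightarrow> 'g set"
  where "inertial_group L G f = {\<sigma> \<in> carrier G. f \<sigma> (inv\<^bsub>G\<^esub> \<sigma>) \<noteq> \<zero>\<^bsub>L\<^esub>}"

definition basis_elem ::
    "('a, 'b) ring_scheme \<Rightarrow> ('a \<Rightarrow> 'a, 'c) monoid_scheme \<Rightarrow> ('a \<Rightarrow> 'a) \<Rightarrow> (('a \<Rightarrow> 'a) \<Rightarrow> 'a)"
  where "basis_elem L G \<sigma> = (\<lambda>\<rho>\<in>carrier G. if \<rho> = \<sigma> then \<one>\<^bsub>L\<^esub> else \<zero>\<^bsub>L\<^esub>)"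

text \<open>
  For finite \<open>G\<close>, the sum of all \<open>x \<sigma> u\<^sub>\<sigma>\<close> is represented by its coefficient function
  \<open>x\<close>. The product is the biadditive extension of
  \<open>(l u\<^sub>\<sigma>) (m u\<^sub>\<tau>) = l \<sigma>(m) f(\<sigma>,\<tau>) u\<^bsub>\<sigma>\<tau>\<^esub>\<close>; the unit is \<open>u\<^sub>1\<close> because \<open>f\<close> is normalized.
\<close>

definition weak_crossed_product ::
    "('a, 'b) ring_scheme \<Rightarrow> ('a \<Rightarrow> 'a, 'c) monoid_scheme \<Rightarrow> (('a \<Rightarrow> 'a) \<Rightarrow> ('a \<Rightarrow> 'a) \<Rightarrow> 'a)
      \<Rightarrow> (('a \<Rightarrow> 'a) \<Rightarrow> 'a) ring"
  where "weak_crossed_product L G f =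
    \<lparr>carrier = carrier G \<rightarrow>\<^sub>E carrier L,
     monoid.mult = (\<lambda>x y. \<lambda>\<rho>\<in>carrier G.
       finsum L (\<lambda>(\<sigma>, \<tau>). x \<sigma> \<otimes>\<^bsub>L\<^esub> \<sigma> (y \<tau>) \<otimes>\<^bsub>L\<^esub> f \<sigma> \<tau>)
         {(\<sigma>, \<tau>). \<sigma> \<in> carrier G \<and> \<tau> \<in> carrier G \<and> \<sigma> \<otimes>\<^bsub>G\<^esub> \<tau> = \<rho>}),
     one = basis_elem L G \<one>\<^bsub>G\<^esub>,
     ring.zero = (\<lambda>\<rho>\<in>carrier G. \<zero>\<^bsub>L\<^esub>),
     ring.add = (\<lambda>x y. \<lambda>\<rho>\<in>carrier G. x \<rho> \<oplus>\<^bsub>L\<^esub> y \<rho>)\<rparr>"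

definition left_ideal :: "'a set \<Rightarrow> ('a, 'b) ring_scheme \<Rightarrow> bool"
  where "left_ideal I A \<longleftrightarrow>
    additive_subgroup I A \<and> (\<forall>x\<in>carrier A. \<forall>i\<in>I. x \<otimes>\<^bsub>A\<^esub> i \<in> I)"

definition maximal_left_ideal :: "'a set \<Rightarrow> ('a, 'b) ring_scheme \<Rightarrow> bool"
  where "maximal_left_ideal I A \<longleftrightarrow>
    left_ideal I A \<and> I \<noteq> carrier A \<and>
    (\<forall>J. left_ideal J A \<and> I \<subseteq> J \<longrightarrow> J = I \<or> J = carrier A)"

definition jacobson_radical :: "('a, 'b) ring_scheme \<Rightarrow> 'a set"
  where "jacobson_radical A = {x \<in> carrier A. \<forall>I. maximal_left_ideal I A \<longrightarrow> x \<in> I}"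

definition N1 ::
    "('a, 'b) ring_scheme \<Rightarrow> ('a \<Rightarrow> 'a, 'c) monoid_scheme \<Rightarrow> (('a \<Rightarrow> 'a) \<Rightarrow> ('a \<Rightarrow> 'a) \<Rightarrow> 'a)
      \<Rightarrow> ('a \<Rightarrow> 'a) set"
  where "N1 L G f =
    (let A = weak_crossed_product L G f; J = jacobson_radical A
     in {\<sigma> \<in> carrier G. basis_elem L G \<sigma> \<in> J \<and> basis_elem L G \<sigma> \<notin> ideal_prod A J J})"

definition double_coset :: "('g, 'c) monoid_scheme \<Rightarrow> 'g set \<Rightarrow> 'g \<Rightarrow> 'g set"
  where "double_coset G H a = (H #>\<^bsub>G\<^esub> a) <#>\<^bsub>G\<^esub> H"

definition raise_on_double_coset ::
    "('g, 'c) monoid_scheme \<Rightarrow> 'g set \<Rightarrow> 'g \<Rightarrow> ('g \<Rightarrow> nat) \<Rightarrow> 'g \<Rightarrow> nat"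
  where "raise_on_double_coset G H a r \<sigma> =
    (if \<sigma> \<in> double_coset G H a then r \<sigma> + 1 else r \<sigma>)"

end

theory Submission
  imports Defs
begin

text \<open>
  The idempotent cocycle makes the product filtered by \<open>r\<close>: elements supported on
  \<open>r \<ge> j\<close> and \<open>r \<ge> k\<close> multiply into those supported on \<open>r \<ge> j + k\<close>. Hence the elements
  supported on \<open>r > 0\<close> form a nilpotent ideal, which lies in the radical, whereas \<open>u\<^sub>\<sigma>\<close> is
  a unit when \<open>r \<sigma> = 0\<close>; so \<open>u\<^sub>\<sigma>\<close> is in the radical iff \<open>\<sigma> \<notin> H\<close>. In particular \<open>a \<notin> H\<close>, which
  gives the normalization and the zero set of the raised function. As \<open>r\<close> is
  \<open>H\<close>-bi-invariant, subadditivity could only fail for \<open>\<sigma>, \<tau> \<notin> H\<close> with \<open>\<sigma>\<tau> = hak\<close> and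
  \<open>r (\<sigma>\<tau>) = r \<sigma> + r \<tau>\<close>; but then \<open>u\<^sub>a\<close> is the product of the radical elements belonging to
  \<open>h\<^sup>-\<^sup>1\<sigma>\<close> and \<open>\<tau>k\<^sup>-\<^sup>1\<close>, so it lies in the square of the radical.
\<close>

section \<open>The Galois group\<close>

lemma Gal_carrierD:
  assumes "s \<in> carrier (Gal L K)"
  shows "s \<in> ring_hom L L" "s \<in> Bij (carrier L)" "\<And>x. x \<in> K \<Longrightarrow> s x = x"
  using assms unfolding Gal_def ring_iso_def Bij_def by auto

text \<open>This restricted \<open>inv_into\<close> is the inverse in \<open>BijGroup\<close>, so
  the lemma yields closure of the Galois group under inverses. \<open>Bij_inv_into_lemma\<close>
  carries each operation compatible with \<open>s\<close> over to the inverse map.\<close>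

lemma (in ring) restrict_inv_into_ring_hom:
  assumes "s \<in> ring_hom R R" and "s \<in> Bij (carrier R)"
  shows "restrict (inv_into (carrier R) s) (carrier R) \<in> ring_hom R R"
proof -
  let ?i = "inv_into (carrier R) s"
  have inj: "inj_on s (carrier R)"
    using assms(2) by (auto simp: Bij_def bij_betw_def)
  have "?i (x \<otimes> y) = ?i x \<otimes> ?i y" "?i (x \<oplus> y) = ?i x \<oplus> ?i y"
    if "x \<in> carrier R" "y \<in> carrier R" for x y
    using Bij_inv_into_lemma[OF _ assms(2), of "(\<otimes>)"] Bij_inv_into_lemma[OF _ assms(2), of "(\<oplus>)"]
      ring_hom_mult[OF assms(1)] ring_hom_add[OF assms(1)] that by auto
  moreover have "?i \<one> = \<one>"
    using inv_into_f_f[OF inj, of \<one>] ring_hom_one[OF assms(1)] by simp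
  ultimately show ?thesis
    using Bij_inv_into_mem[OF assms(2)] by (auto intro!: ring_hom_memI)
qed

lemma (in ring) group_Gal:
  assumes "K \<subseteq> carrier R"
  shows "group (Gal R K)"
proof -
  let ?B = "BijGroup (carrier R)"
  let ?H = "carrier (Gal R K)"
  interpret B: group ?B by (rule group_BijGroup)
  have mem: "s \<in> ?H \<longleftrightarrow> s \<in> ring_hom R R \<and> s \<in> Bij (carrier R) \<and> (\<forall>x\<in>K. s x = x)" for s
    unfolding Gal_def ring_iso_def Bij_def by auto
  have "subgroup ?H ?B"
  proof (rule B.subgroupI)
    show "?H \<subseteq> carrier ?B"
      using Gal_carrierD(2) by (auto simp: BijGroup_def)
    have "(\<lambda>x\<in>carrier R. x) \<in> ?H"
      using assms unfolding mem by (auto simp: id_Bij intro!: ring_hom_memI)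
    then show "?H \<noteq> {}" by auto
  next
    fix s assume "s \<in> ?H"
    note s = this[THEN Gal_carrierD(1)] this[THEN Gal_carrierD(2)] this[THEN Gal_carrierD(3)]
    have "inj_on s (carrier R)"
      using s(2) by (auto simp: Bij_def bij_betw_def)
    then have "inv_into (carrier R) s x = x" if "x \<in> K" for x
      using inv_into_f_f[of s "carrier R" x] s(3)[OF that] that assms by auto
    then show "inv\<^bsub>?B\<^esub> s \<in> ?H"
      using restrict_inv_into_ring_hom[OF s(1,2)] restrict_inv_into_Bij[OF s(2)] assms
      unfolding inv_BijGroup[OF s(2)] mem by auto
  next
    fix s t assume st: "s \<in> ?H" "t \<in> ?H"
    note h = st[THEN Gal_carrierD(1)] and b = st[THEN Gal_carrierD(2)]
    have "compose (carrier R) s t \<in> ring_hom R R"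
      by (rule ring_hom_memI)
        (use ring_hom_closed[OF h(1)] ring_hom_closed[OF h(2)] ring_hom_mult[OF h(1)]
          ring_hom_mult[OF h(2)] ring_hom_add[OF h(1)] ring_hom_add[OF h(2)]
          ring_hom_one[OF h(1)] ring_hom_one[OF h(2)] in \<open>auto simp: compose_eq\<close>)
    moreover have "compose (carrier R) s t x = x" if "x \<in> K" for x
      using that assms st[THEN Gal_carrierD(3)] by (auto simp: compose_def)
    ultimately show "s \<otimes>\<^bsub>?B\<^esub> t \<in> ?H"
      using compose_Bij[OF b] b unfolding mem by (auto simp: BijGroup_def)
  qed
  moreover have "Gal R K = ?B\<lparr>carrier := ?H\<rparr>"
    by (simp add: Gal_def)
  ultimately show ?thesis
    using B.subgroup_imp_group by metis
qed

text \<open>An automorphism is determined by its values on a \<open>K\<close>-basis, and it sends each basis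
  element to a root of a polynomial depending only on that element.\<close>

lemma (in field) finite_Gal:
  assumes K: "subfield K R" and fd: "finite_dimension K (carrier R)"
  shows "finite (carrier (Gal R K))"
proof -
  have KR: "K \<subseteq> carrier R" and Ks: "subring K R"
    using subfieldE[OF K] by auto
  obtain Us where Us: "set Us \<subseteq> carrier R" "Span K Us = carrier R"
    using exists_base[OF K finite_dimensionE[OF K fd]] by blast
  have ring_hom: "ring_hom_ring R R s" if "s \<in> carrier (Gal R K)" for s
    using Gal_carrierD(1)[OF that] by (intro ring_hom_ringI2 ring_axioms)
  have orbit: "finite ((\<lambda>s. s x) ` carrier (Gal R K))" if x: "x \<in> carrier R" for x
  proof -
    have "(algebraic over K) x"
      using finite_dimension_imp_algebraic[OF K carrier_is_subring fd x] .
    then obtain p where p: "p \<in> carrier (K[X])" "p \<noteq> []" "eval p x = \<zero>"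
      using algebraicE[OF Ks x] by blast
    have pK: "set p \<subseteq> K"
      using p(1) unfolding sym[OF univ_poly_carrier] polynomial_def by auto
    \<comment> \<open>Roots are counted in the whole field, so \<open>p\<close> is regarded as a
      polynomial over \<open>R\<close> rather than over \<open>K\<close>.\<close>
    have "p \<in> carrier (poly_ring R)"
      using p(1) pK KR unfolding sym[OF univ_poly_carrier] polynomial_def by auto
    then have "finite {y. is_root p y}"
      by (rule finite_number_of_roots)
    moreover have "is_root p (s x)" if s: "s \<in> carrier (Gal R K)" for s
    proof -
      interpret h: ring_hom_ring R R s by (rule ring_hom[OF s])
      have "map s p = p"
        using pK Gal_carrierD(3)[OF s] by (auto intro!: map_idI)
      then have "eval p (s x) = \<zero>"
        using h.eval_hom'[OF x, of p] pK KR p(3) by auto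
      then show ?thesis
        using p(2) x by (simp add: is_root_def)
    qed
    ultimately show ?thesis
      by (rule_tac finite_subset[of _ "{y. is_root p y}"]) auto
  qed
  define V where "V = (\<Union>x\<in>set Us. (\<lambda>s. s x) ` carrier (Gal R K))"
  have V: "s x \<in> V" if "s \<in> carrier (Gal R K)" "x \<in> set Us" for s x
    unfolding V_def using that by (intro UN_I[OF that(2)] imageI)
  have "inj_on (\<lambda>s. map s Us) (carrier (Gal R K))"
  proof (rule inj_onI)
    fix s t assume st: "s \<in> carrier (Gal R K)" "t \<in> carrier (Gal R K)" "map s Us = map t Us"
    have "s x = t x" if x: "x \<in> carrier R" for x
    proof -
      obtain Ks where Ks: "set Ks \<subseteq> K" "x = combine Ks Us"
        using x[folded Us(2), unfolded Span_eq_combine_set[OF K Us(1)]] by blast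
      interpret s: ring_hom_ring R R s by (rule ring_hom[OF st(1)])
      interpret t: ring_hom_ring R R t by (rule ring_hom[OF st(2)])
      have KsR: "set Ks \<subseteq> carrier R"
        using Ks(1) KR by blast
      \<comment> \<open>The coefficients lie in \<open>K\<close>, where both maps are the identity;
        the values on \<open>Us\<close> thus decide the value at \<open>x\<close>.\<close>
      have "map s Ks = map t Ks"
        using Ks(1) st(1,2)[THEN Gal_carrierD(3)] by auto
      then show ?thesis
        using s.combine_hom[OF KsR Us(1)] t.combine_hom[OF KsR Us(1)] Ks(2) st(3) by metis
    qed
    \<comment> \<open>Equality on the carrier suffices, since members of \<open>Bij\<close> are
      extensional.\<close>
    then show "s = t"
      using st(1,2)[THEN Gal_carrierD(2)] by (auto simp: Bij_def intro: extensionalityI)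
  qed
  moreover have "(\<lambda>s. map s Us) ` carrier (Gal R K) \<subseteq> {xs. set xs \<subseteq> V \<and> length xs = length Us}"
    using V by auto
  moreover have "finite V"
    unfolding V_def using orbit Us(1) by auto
  ultimately show ?thesis
    using finite_lists_length_eq[of V "length Us"] by (meson finite_subset inj_on_finite)
qed

section \<open>Maximal left ideals\<close>

lemma left_ideal_eq_carrier:
  assumes "left_ideal I A" and "\<one>\<^bsub>A\<^esub> \<in> I"
    and "\<And>x. x \<in> carrier A \<Longrightarrow> x \<otimes>\<^bsub>A\<^esub> \<one>\<^bsub>A\<^esub> = x"
  shows "I = carrier A"
  using assms additive_subgroup.a_subset unfolding left_ideal_def by fastforce

text \<open>\<open>abelian_group\<close> supplies laws for the addition only, so the law for the
  product is an explicit hypothesis. This lets the lemma apply to \<open>A\<close>, handled as an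
  additive group with a product.\<close>

lemma (in abelian_group) left_ideal_set_add:
  assumes I: "left_ideal I G" and J: "left_ideal J G"
    and r_distr: "\<And>x y z. \<lbrakk>x \<in> carrier G; y \<in> carrier G; z \<in> carrier G\<rbrakk>
      \<Longrightarrow> x \<otimes> (y \<oplus> z) = x \<otimes> y \<oplus> x \<otimes> z"
  shows "left_ideal (I <+>\<^bsub>G\<^esub> J) G"
proof -
  have sub: "additive_subgroup I G" "additive_subgroup J G"
    using I J by (auto simp: left_ideal_def)
  have "x \<otimes> z \<in> I <+>\<^bsub>G\<^esub> J" if x: "x \<in> carrier G" and z: "z \<in> I <+>\<^bsub>G\<^esub> J" for x z
  proof -
    obtain i j where ij: "i \<in> I" "j \<in> J" "z = i \<oplus> j"
      using z by (auto simp: set_add_def')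
    have "x \<otimes> z = x \<otimes> i \<oplus> x \<otimes> j"
      using r_distr[OF x] ij sub[THEN additive_subgroup.a_subset] by auto
    then show ?thesis
      using I J x ij(1,2) unfolding left_ideal_def set_add_def' by blast
  qed
  then show ?thesis
    using add_additive_subgroups[OF sub] by (auto simp: left_ideal_def)
qed

text \<open>Zorn's lemma for the left ideals that omit the unit. Existence matters because the
  radical is an intersection of maximal left ideals: with none at hand it would be the whole carrier
  and exclude no unit.\<close>

lemma (in abelian_group) exists_maximal_left_ideal:
  assumes one: "\<one> \<in> carrier G" "\<one> \<noteq> \<zero>"
    and closed: "\<And>x y. \<lbrakk>x \<in> carrier G; y \<in> carrier G\<rbrakk> \<Longrightarrow> x \<otimes> y \<in> carrier G"
    and r_one: "\<And>x. x \<in> carrier G \<Longrightarrow> x \<otimes> \<one> = x"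
    and r_distr: "\<And>x y z. \<lbrakk>x \<in> carrier G; y \<in> carrier G; z \<in> carrier G\<rbrakk>
      \<Longrightarrow> x \<otimes> (y \<oplus> z) = x \<otimes> y \<oplus> x \<otimes> z"
  obtains M where "maximal_left_ideal M G"
proof -
  let ?S = "{I. left_ideal I G \<and> \<one> \<notin> I}"
  \<comment> \<open>Cancel in \<open>x 0 = x (0 + 0) = x 0 + x 0\<close>. This makes the zero ideal
    a left ideal, the starting point for Zorn.\<close>
  have "x \<otimes> \<zero> = \<zero>" if "x \<in> carrier G" for x
    using r_distr[OF that zero_closed zero_closed] closed[OF that zero_closed]
    by (metis l_zero r_zero zero_closed add.l_cancel)
  then have "left_ideal {\<zero>} G"
    by (auto simp: left_ideal_def intro!: additive_subgroupI add.subgroupI)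
  then have ne: "?S \<noteq> {}"
    using one by auto
  have "\<Union>C \<in> ?S" if C: "C \<noteq> {}" "subset.chain ?S C" for C
  proof -
    have mem: "left_ideal I G" "\<one> \<notin> I" "additive_subgroup I G" if "I \<in> C" for I
      using C(2) that by (auto simp: subset.chain_def left_ideal_def)
    have "additive_subgroup (\<Union>C) G"
    proof (intro additive_subgroupI add.subgroupI)
      show "\<Union>C \<subseteq> carrier G"
        using mem(3)[THEN additive_subgroup.a_subset] by auto
      show "\<Union>C \<noteq> {}"
        using C(1) mem(3)[THEN additive_subgroup.zero_closed] by auto
    next
      fix x assume "x \<in> \<Union>C"
      then show "\<ominus> x \<in> \<Union>C"
        using mem(3)[THEN additive_subgroup.a_subgroup, THEN subgroup.m_inv_closed]
        by (auto simp: a_inv_def)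
    next
      fix x y assume "x \<in> \<Union>C" "y \<in> \<Union>C"
      then obtain I J where IJ: "x \<in> I" "y \<in> J" "I \<in> C" "J \<in> C"
        by auto
      then have "I \<subseteq> J \<or> J \<subseteq> I"
        using C(2) by (auto simp: subset_chain_def)
      then obtain I' where "I' \<in> C" "x \<in> I'" "y \<in> I'"
        using IJ by auto
      then show "x \<oplus> y \<in> \<Union>C"
        using mem(3)[THEN additive_subgroup.a_closed] by auto
    qed
    then show ?thesis
      using mem by (auto simp: left_ideal_def)
  qed
  then obtain M where M: "M \<in> ?S" "\<And>I. \<lbrakk>I \<in> ?S; M \<subseteq> I\<rbrakk> \<Longrightarrow> I = M"
    using subset_Zorn_nonempty[OF ne] by meson
  \<comment> \<open>A larger left ideal either omits the unit, and equals \<open>M\<close>, or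
    contains it, and is everything.\<close>
  have "maximal_left_ideal M G"
    unfolding maximal_left_ideal_def
    using M left_ideal_eq_carrier[OF _ _ r_one] one(1) by blast
  then show thesis
    by (rule that)
qed

section \<open>The radical of the weak crossed product\<close>

text \<open>The interface to the Galois group: a finite group whose elements are themselves maps on
  \<open>L\<close>, so that the action is plain application.\<close>

locale idem_crossed_product = L: field L + G: group G
  for L :: "('a, 'b) ring_scheme" (structure) and G :: "('a \<Rightarrow> 'a) monoid" +
  fixes r :: "('a \<Rightarrow> 'a) \<Rightarrow> nat"
  assumes finite_G: "finite (carrier G)"
    and act_hom: "s \<in> carrier G \<Longrightarrow> s \<in> ring_hom L L"
    and r_Sl: "r \<in> Sl G"
begin

abbreviation e where "e \<equiv> idem_cocycle L G r"
definition A where "A = weak_crossed_product L G e"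
abbreviation u where "u \<equiv> basis_elem L G"

section \<open>Subadditive functions on a finite group\<close>

lemma r_one: "r \<one>\<^bsub>G\<^esub> = 0"
  using r_Sl by (auto simp: Sl_def)

lemma r_mult_le: "\<lbrakk>s \<in> carrier G; t \<in> carrier G\<rbrakk> \<Longrightarrow> r (s \<otimes>\<^bsub>G\<^esub> t) \<le> r s + r t"
  using r_Sl by (auto simp: Sl_def)

text \<open>In a finite group the inverse of \<open>s\<close> is a power of \<open>s\<close>, and
  subadditivity forces \<open>r\<close> to vanish on all powers.\<close>

lemma r_inv_zero:
  assumes s: "s \<in> carrier G" "r s = 0"
  shows "r (inv\<^bsub>G\<^esub> s) = 0"
proof -
  have pow: "r (s [^]\<^bsub>G\<^esub> (n::nat)) = 0" for n
  proof (induction n)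
    case (Suc n)
    then show ?case
      using r_mult_le[of "s [^]\<^bsub>G\<^esub> n" s] s by simp
  qed (simp add: r_one)
  have "order G > 0"
    using finite_G G.order_gt_0_iff_finite by blast
  then have "s \<otimes>\<^bsub>G\<^esub> (s [^]\<^bsub>G\<^esub> (order G - 1)) = \<one>\<^bsub>G\<^esub>"
    using G.pow_order_eq_1[OF s(1)] s(1) by (metis G.nat_pow_Suc2 Suc_diff_1)
  then have "inv\<^bsub>G\<^esub> s = s [^]\<^bsub>G\<^esub> (order G - 1)"
    using s(1) G.inv_equality G.nat_pow_closed by (metis G.inv_comm)
  then show ?thesis
    using pow by simp
qed

text \<open>Subadditivity gives one inequality for \<open>h\<close> and the other for its inverse.
  With the right-hand version, \<open>r\<close> is constant on double cosets of its zero
  set.\<close>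

lemma r_mult_zero_left:
  assumes "h \<in> carrier G" "s \<in> carrier G" "r h = 0"
  shows "r (h \<otimes>\<^bsub>G\<^esub> s) = r s"
proof (rule antisym)
  show "r (h \<otimes>\<^bsub>G\<^esub> s) \<le> r s"
    using r_mult_le[of h s] assms by simp
  have "inv\<^bsub>G\<^esub> h \<otimes>\<^bsub>G\<^esub> (h \<otimes>\<^bsub>G\<^esub> s) = s"
    using assms by (simp flip: G.m_assoc)
  then show "r s \<le> r (h \<otimes>\<^bsub>G\<^esub> s)"
    using r_mult_le[of "inv\<^bsub>G\<^esub> h" "h \<otimes>\<^bsub>G\<^esub> s"] assms r_inv_zero by simp
qed

lemma r_mult_zero_right:
  assumes "h \<in> carrier G" "s \<in> carrier G" "r h = 0"
  shows "r (s \<otimes>\<^bsub>G\<^esub> h) = r s"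
proof (rule antisym)
  show "r (s \<otimes>\<^bsub>G\<^esub> h) \<le> r s"
    using r_mult_le[of s h] assms by simp
  have "s \<otimes>\<^bsub>G\<^esub> h \<otimes>\<^bsub>G\<^esub> inv\<^bsub>G\<^esub> h = s"
    using assms by (simp add: G.m_assoc)
  then show "r s \<le> r (s \<otimes>\<^bsub>G\<^esub> h)"
    using r_mult_le[of "s \<otimes>\<^bsub>G\<^esub> h" "inv\<^bsub>G\<^esub> h"] assms r_inv_zero by simp
qed

text \<open>The cocycle is nonzero at \<open>s\<close> and its inverse iff their
  \<open>r\<close>-values add up to \<open>r 1 = 0\<close>, that is, iff both vanish; by
  \<open>r_inv_zero\<close> it is enough that \<open>r s = 0\<close>.\<close>

lemma inertial_group_eq: "inertial_group L G e = zero_subgroup G r"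
  using r_inv_zero r_one
  by (auto simp: inertial_group_def zero_subgroup_def idem_cocycle_def)

section \<open>Coefficientwise arithmetic in \<open>A\<close>\<close>

lemma e_closed: "e s t \<in> carrier L"
  by (simp add: idem_cocycle_def)

lemma act_closed: "\<lbrakk>s \<in> carrier G; x \<in> carrier L\<rbrakk> \<Longrightarrow> s x \<in> carrier L"
  using act_hom ring_hom_closed by metis

lemma act_one: "s \<in> carrier G \<Longrightarrow> s \<one> = \<one>"
  using act_hom ring_hom_one by metis

lemma act_add:
  "\<lbrakk>s \<in> carrier G; x \<in> carrier L; y \<in> carrier L\<rbrakk> \<Longrightarrow> s (x \<oplus> y) = s x \<oplus> s y"
  using act_hom ring_hom_add by metis

lemma act_zero: "s \<in> carrier G \<Longrightarrow> s \<zero> = \<zero>"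
  using act_hom ring_hom_zero L.ring_axioms by metis

lemma carrier_A: "carrier A = carrier G \<rightarrow>\<^sub>E carrier L"
  by (simp add: A_def weak_crossed_product_def)

lemma A_coeff: "\<lbrakk>x \<in> carrier A; s \<in> carrier G\<rbrakk> \<Longrightarrow> x s \<in> carrier L"
  by (auto simp: carrier_A)

lemma A_eqI:
  "\<lbrakk>x \<in> carrier A; y \<in> carrier A; \<And>s. s \<in> carrier G \<Longrightarrow> x s = y s\<rbrakk> \<Longrightarrow> x = y"
  unfolding carrier_A by (rule PiE_ext)

lemma A_add: "s \<in> carrier G \<Longrightarrow> (x \<oplus>\<^bsub>A\<^esub> y) s = x s \<oplus> y s"
  by (simp add: A_def weak_crossed_product_def)

lemma A_zero: "s \<in> carrier G \<Longrightarrow> \<zero>\<^bsub>A\<^esub> s = \<zero>"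
  by (simp add: A_def weak_crossed_product_def)

lemma A_one: "\<one>\<^bsub>A\<^esub> = u \<one>\<^bsub>G\<^esub>"
  by (simp add: A_def weak_crossed_product_def)

lemma u_closed: "u s \<in> carrier A"
  by (auto simp: carrier_A basis_elem_def)

definition fibre where
  "fibre \<rho> = {(s, t). s \<in> carrier G \<and> t \<in> carrier G \<and> s \<otimes>\<^bsub>G\<^esub> t = \<rho>}"

lemma finite_fibre: "finite (fibre \<rho>)"
  by (rule finite_subset[of _ "carrier G \<times> carrier G"]) (auto simp: fibre_def finite_G)

lemma A_mult:
  "\<rho> \<in> carrier G \<Longrightarrow>
    (x \<otimes>\<^bsub>A\<^esub> y) \<rho> = finsum L (\<lambda>(s, t). x s \<otimes> s (y t) \<otimes> e s t) (fibre \<rho>)"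
  by (simp add: A_def weak_crossed_product_def fibre_def)

lemma A_summand:
  assumes "x \<in> carrier A" "y \<in> carrier A"
  shows "(\<lambda>(s, t). x s \<otimes> s (y t) \<otimes> e s t) \<in> fibre \<rho> \<rightarrow> carrier L"
  using assms by (auto simp: fibre_def A_coeff act_closed e_closed)

lemma A_mult_closed: "\<lbrakk>x \<in> carrier A; y \<in> carrier A\<rbrakk> \<Longrightarrow> x \<otimes>\<^bsub>A\<^esub> y \<in> carrier A"
  using L.finsum_closed[OF A_summand]
  by (auto simp: carrier_A A_mult A_def weak_crossed_product_def fibre_def)

lemma A_add_closed: "\<lbrakk>x \<in> carrier A; y \<in> carrier A\<rbrakk> \<Longrightarrow> x \<oplus>\<^bsub>A\<^esub> y \<in> carrier A"
  by (auto simp: A_def weak_crossed_product_def)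

lemma A_zero_closed: "\<zero>\<^bsub>A\<^esub> \<in> carrier A"
  by (auto simp: A_def weak_crossed_product_def)

lemma abelian_group_A: "abelian_group A"
proof (rule abelian_groupI)
  show "\<zero>\<^bsub>A\<^esub> \<oplus>\<^bsub>A\<^esub> x = x" if "x \<in> carrier A" for x
    using that by (auto intro!: A_eqI A_add_closed A_zero_closed simp: A_add A_zero A_coeff)
next
  fix x assume x: "x \<in> carrier A"
  let ?y = "\<lambda>s\<in>carrier G. \<ominus> x s"
  have "?y \<in> carrier A"
    using x by (auto simp: carrier_A)
  moreover have "?y \<oplus>\<^bsub>A\<^esub> x = \<zero>\<^bsub>A\<^esub>"
    using x \<open>?y \<in> carrier A\<close>
    by (auto intro!: A_eqI A_add_closed A_zero_closed simp: A_add A_zero A_coeff L.l_neg)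
  ultimately show "\<exists>y\<in>carrier A. y \<oplus>\<^bsub>A\<^esub> x = \<zero>\<^bsub>A\<^esub>"
    by blast
qed (auto intro!: A_eqI A_add_closed A_zero_closed simp: A_add A_coeff L.a_ac)

lemma A_r_distr:
  assumes "x \<in> carrier A" "y \<in> carrier A" "z \<in> carrier A"
  shows "x \<otimes>\<^bsub>A\<^esub> (y \<oplus>\<^bsub>A\<^esub> z) = x \<otimes>\<^bsub>A\<^esub> y \<oplus>\<^bsub>A\<^esub> x \<otimes>\<^bsub>A\<^esub> z"
proof (rule A_eqI)
  fix \<rho> assume \<rho>: "\<rho> \<in> carrier G"
  let ?f = "\<lambda>y (s, t). x s \<otimes> s (y t) \<otimes> e s t"
  have "finsum L (?f (y \<oplus>\<^bsub>A\<^esub> z)) (fibre \<rho>) = finsum L (\<lambda>p. ?f y p \<oplus> ?f z p) (fibre \<rho>)"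
    using assms
    by (intro L.finsum_cong')
      (auto simp: fibre_def A_add act_add A_coeff act_closed e_closed L.r_distr L.l_distr)
  also have "\<dots> = finsum L (?f y) (fibre \<rho>) \<oplus> finsum L (?f z) (fibre \<rho>)"
    using assms by (intro L.finsum_addf A_summand)
  finally show "(x \<otimes>\<^bsub>A\<^esub> (y \<oplus>\<^bsub>A\<^esub> z)) \<rho> = (x \<otimes>\<^bsub>A\<^esub> y \<oplus>\<^bsub>A\<^esub> x \<otimes>\<^bsub>A\<^esub> z) \<rho>"
    using \<rho> by (simp add: A_mult A_add)
qed (simp_all add: assms A_mult_closed A_add_closed)

text \<open>As \<open>u t\<close> is supported at \<open>t\<close>, only the pair \<open>?p\<close>
  of the fibre contributes to the convolution sum.\<close>

lemma A_mult_basis: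
  assumes x: "x \<in> carrier A" and t: "t \<in> carrier G" and \<rho>: "\<rho> \<in> carrier G"
  shows "(x \<otimes>\<^bsub>A\<^esub> u t) \<rho> = x (\<rho> \<otimes>\<^bsub>G\<^esub> inv\<^bsub>G\<^esub> t) \<otimes> e (\<rho> \<otimes>\<^bsub>G\<^esub> inv\<^bsub>G\<^esub> t) t"
proof -
  let ?p = "(\<rho> \<otimes>\<^bsub>G\<^esub> inv\<^bsub>G\<^esub> t, t)"
  let ?f = "\<lambda>(s, t'). x s \<otimes> s (u t t') \<otimes> e s t'"
  have p: "?p \<in> fibre \<rho>"
    using t \<rho> by (auto simp: fibre_def G.m_assoc)
  have if_eq: "(if ?p = q then ?f q else \<zero>) = ?f q" if q: "q \<in> fibre \<rho>" for q
  proof -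
    obtain s t' where q': "q = (s, t')" "s \<in> carrier G" "t' \<in> carrier G" "s \<otimes>\<^bsub>G\<^esub> t' = \<rho>"
      using q by (auto simp: fibre_def)
    then have "s = \<rho> \<otimes>\<^bsub>G\<^esub> inv\<^bsub>G\<^esub> t'"
      by (auto simp: G.m_assoc)
    then show ?thesis
      using q' x by (auto simp: basis_elem_def act_zero A_coeff e_closed)
  qed
  \<comment> \<open>The summand is rewritten as an indicator of \<open>?p\<close>, the shape that
    \<open>finprod_singleton\<close> evaluates.\<close>
  have "finsum L ?f (fibre \<rho>) = finsum L (\<lambda>q. if ?p = q then ?f q else \<zero>) (fibre \<rho>)"
    by (rule L.finsum_cong'[OF refl A_summand[OF x u_closed] if_eq, symmetric])
  also have "\<dots> = ?f ?p"
    by (rule L.add.finprod_singleton[OF p finite_fibre A_summand[OF x u_closed]])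
  finally show ?thesis
    using x t \<rho> by (simp add: A_mult basis_elem_def act_one A_coeff)
qed

lemma A_r_one: "x \<in> carrier A \<Longrightarrow> x \<otimes>\<^bsub>A\<^esub> \<one>\<^bsub>A\<^esub> = x"
  unfolding A_one
  by (rule A_eqI)
    (auto simp: A_mult_closed u_closed A_mult_basis A_coeff idem_cocycle_def r_one)

text \<open>Used twice: to see that \<open>u s\<close> has a left inverse when
  \<open>r s = 0\<close>, and to factor \<open>u a\<close> into radical elements.\<close>

lemma u_mult:
  assumes s: "s \<in> carrier G" and t: "t \<in> carrier G"
    and add: "r (s \<otimes>\<^bsub>G\<^esub> t) = r s + r t"
  shows "u s \<otimes>\<^bsub>A\<^esub> u t = u (s \<otimes>\<^bsub>G\<^esub> t)"
proof (rule A_eqI)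
  fix \<rho> assume \<rho>: "\<rho> \<in> carrier G"
  have "\<rho> \<otimes>\<^bsub>G\<^esub> inv\<^bsub>G\<^esub> t = s \<longleftrightarrow> \<rho> = s \<otimes>\<^bsub>G\<^esub> t"
    using s t \<rho> G.inv_solve_right' by (metis G.inv_solve_right)
  moreover have "(u s \<otimes>\<^bsub>A\<^esub> u t) \<rho>
      = u s (\<rho> \<otimes>\<^bsub>G\<^esub> inv\<^bsub>G\<^esub> t) \<otimes> e (\<rho> \<otimes>\<^bsub>G\<^esub> inv\<^bsub>G\<^esub> t) t"
    by (rule A_mult_basis[OF u_closed t \<rho>])
  moreover have "e s t = \<one>"
    using add by (simp add: idem_cocycle_def)
  ultimately show "(u s \<otimes>\<^bsub>A\<^esub> u t) \<rho> = u (s \<otimes>\<^bsub>G\<^esub> t) \<rho>"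
    using s t \<rho> e_closed by (cases "\<rho> = s \<otimes>\<^bsub>G\<^esub> t") (simp_all add: basis_elem_def)
qed (simp_all add: u_closed A_mult_closed)

section \<open>The filtration of \<open>A\<close> by \<open>r\<close>, and the radical\<close>

definition filtration where
  "filtration k = {x \<in> carrier A. \<forall>\<rho>\<in>carrier G. r \<rho> < k \<longrightarrow> x \<rho> = \<zero>}"

text \<open>In a summand at \<open>\<rho>\<close> with \<open>r \<rho> < j + k\<close>, either the
  coefficient of \<open>x\<close> or of \<open>y\<close> vanishes, or \<open>r s + r t\<close>
  exceeds \<open>r \<rho>\<close> and the cocycle itself is zero.\<close>

lemma filtration_mult:
  assumes x: "x \<in> filtration j" and y: "y \<in> filtration k"
  shows "x \<otimes>\<^bsub>A\<^esub> y \<in> filtration (j + k)"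
proof -
  have A: "x \<in> carrier A" "y \<in> carrier A"
    using x y by (auto simp: filtration_def)
  have "(x \<otimes>\<^bsub>A\<^esub> y) \<rho> = \<zero>" if \<rho>: "\<rho> \<in> carrier G" "r \<rho> < j + k" for \<rho>
  proof -
    have "x s \<otimes> s (y t) \<otimes> e s t = \<zero>" if st: "(s, t) \<in> fibre \<rho>" for s t
    proof -
      have st: "s \<in> carrier G" "t \<in> carrier G" "s \<otimes>\<^bsub>G\<^esub> t = \<rho>"
        using st by (auto simp: fibre_def)
      consider "r s < j" | "r t < k" | "r \<rho> < r s + r t"
        using \<rho>(2) by linarith
      then show ?thesis
      proof cases
        case 1
        then show ?thesis
          using x st A by (simp add: filtration_def A_coeff act_closed e_closed)
      next
        case 2
        then show ?thesis
          using y st A by (simp add: filtration_def A_coeff act_zero e_closed)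
      next
        case 3
        then have "e s t = \<zero>"
          using st by (simp add: idem_cocycle_def)
        then show ?thesis
          using st A by (simp add: A_coeff act_closed)
      qed
    qed
    then show ?thesis
      unfolding A_mult[OF \<rho>(1)] by (intro L.add.finprod_one_eqI) auto
  qed
  then show ?thesis
    using A by (auto simp: filtration_def A_mult_closed)
qed

lemma filtration_antimono: "j \<le> k \<Longrightarrow> filtration k \<subseteq> filtration j"
  by (auto simp: filtration_def)

lemma left_ideal_filtration: "left_ideal (filtration k) A"
proof -
  interpret A: abelian_group A by (rule abelian_group_A)
  have neg: "(\<ominus>\<^bsub>A\<^esub> x) \<rho> = \<ominus> x \<rho>" if "x \<in> carrier A" "\<rho> \<in> carrier G" for x \<rho>
    using that A_add[of \<rho> "\<ominus>\<^bsub>A\<^esub> x" x] A_zero[of \<rho>] A.l_neg[of x]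
    by (metis A.a_inv_closed A_coeff L.minus_equality)
  have "additive_subgroup (filtration k) A"
  proof (intro additive_subgroupI A.add.subgroupI)
    show "filtration k \<noteq> {}"
      using A.zero_closed A_zero by (auto simp: filtration_def)
  qed (auto simp: filtration_def A_add neg simp flip: a_inv_def)
  \<comment> \<open>Absorption is the case \<open>j = 0\<close> of \<open>filtration_mult\<close>,
    because \<open>filtration 0\<close> is all of \<open>A\<close>.\<close>
  moreover have "x \<otimes>\<^bsub>A\<^esub> y \<in> filtration k" if "x \<in> carrier A" "y \<in> filtration k" for x y
    using filtration_mult[of x 0 y k] that by (simp add: filtration_def)
  ultimately show ?thesis
    by (simp add: left_ideal_def)
qed

text \<open>If \<open>filtration k\<close> is not contained in \<open>M\<close>, then \<open>1 = m + y\<close> with \<open>m \<in> M\<close>,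
  \<open>y \<in> filtration k\<close>, and \<open>y = y m + y y\<close> with \<open>y y \<in> filtration (k + 1) \<subseteq> M\<close>. This downward
  induction avoids associativity of \<open>A\<close>.\<close>

lemma filtration_subset_maximal:
  assumes M: "maximal_left_ideal M A"
  shows "filtration 1 \<subseteq> M"
proof -
  interpret A: abelian_group A by (rule abelian_group_A)
  have lM: "left_ideal M A" and neq: "M \<noteq> carrier A"
    and max: "\<And>J. \<lbrakk>left_ideal J A; M \<subseteq> J\<rbrakk> \<Longrightarrow> J = M \<or> J = carrier A"
    using M by (auto simp: maximal_left_ideal_def)
  interpret M: additive_subgroup M A
    using lM by (simp add: left_ideal_def)
  have one: "\<one>\<^bsub>A\<^esub> \<notin> M"
    using left_ideal_eq_carrier[OF lM _ A_r_one] neq by blast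
  \<comment> \<open>The successor makes the bound on \<open>r\<close> strict, so that
    \<open>filtration n\<close> is zero, and it gives \<open>1 \<le> n\<close> for the downward
    induction.\<close>
  define n where "n = Suc (Max (r ` carrier G))"
  have bound: "r \<rho> < n" if "\<rho> \<in> carrier G" for \<rho>
    using that finite_G by (simp add: n_def less_Suc_eq_le)
  have "1 \<le> n"
    by (simp add: n_def)
  then show ?thesis
  proof (induction rule: inc_induct)
    case base
    have "x = \<zero>\<^bsub>A\<^esub>" if "x \<in> filtration n" for x
      using that bound by (intro A_eqI) (auto simp: filtration_def A_zero)
    then show ?case
      using M.zero_closed by (metis subsetI)
  next
    case (step k)
    interpret N: additive_subgroup "filtration k" A
      using left_ideal_filtration by (simp add: left_ideal_def)
    show ?case
    proof (rule ccontr)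
      assume notsub: "\<not> filtration k \<subseteq> M"
      let ?J = "M <+>\<^bsub>A\<^esub> filtration k"
      have "left_ideal ?J A"
        using A.left_ideal_set_add[OF lM left_ideal_filtration A_r_distr] by blast
      moreover have "M \<subseteq> ?J"
      proof
        fix x assume x: "x \<in> M"
        then have "x \<oplus>\<^bsub>A\<^esub> \<zero>\<^bsub>A\<^esub> \<in> ?J"
          unfolding set_add_def' using N.zero_closed by blast
        then show "x \<in> ?J"
          by (simp add: A.r_zero[OF M.a_Hcarr[OF x]])
      qed
      moreover have "filtration k \<subseteq> ?J"
      proof
        fix x assume x: "x \<in> filtration k"
        then have "\<zero>\<^bsub>A\<^esub> \<oplus>\<^bsub>A\<^esub> x \<in> ?J"
          unfolding set_add_def' using M.zero_closed by blast
        then show "x \<in> ?J"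
          by (simp add: A.l_zero[OF N.a_Hcarr[OF x]])
      qed
      ultimately have "?J = carrier A"
        using max[of ?J] notsub by blast
      then obtain m y where my: "m \<in> M" "y \<in> filtration k" "\<one>\<^bsub>A\<^esub> = m \<oplus>\<^bsub>A\<^esub> y"
        using u_closed[of "\<one>\<^bsub>G\<^esub>"] unfolding A_one[symmetric] set_add_def' by blast
      have yA: "y \<in> carrier A" and mA: "m \<in> carrier A"
        using my by auto
      have "y = y \<otimes>\<^bsub>A\<^esub> m \<oplus>\<^bsub>A\<^esub> y \<otimes>\<^bsub>A\<^esub> y"
        using A_r_one[OF yA] A_r_distr[OF yA mA yA] my(3) by simp
      moreover have "y \<otimes>\<^bsub>A\<^esub> m \<in> M"
        using lM my(1) yA by (simp add: left_ideal_def)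
      \<comment> \<open>The square lies in \<open>filtration (k + k)\<close>, and
        \<open>Suc k \<le> k + k\<close> because \<open>1 \<le> k\<close>.\<close>
      moreover have "y \<otimes>\<^bsub>A\<^esub> y \<in> filtration (Suc k)"
        using filtration_mult[OF my(2) my(2)] filtration_antimono[of "Suc k" "k + k"] step.hyps
        by auto
      ultimately have "y \<in> M"
        using step.IH M.a_closed by (metis subsetD)
      then show False
        using my one M.a_closed by metis
    qed
  qed
qed

text \<open>If \<open>r s\<close> is positive, \<open>u s\<close> lies in
  \<open>filtration 1\<close> and so in every maximal left ideal. If \<open>r s = 0\<close>, its
  left inverse would put the unit into a maximal left ideal, and one exists.\<close>

lemma u_in_radical_iff:
  assumes s: "s \<in> carrier G"
  shows "u s \<in> jacobson_radical A \<longleftrightarrow> r s \<noteq> 0"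
proof
  assume "r s \<noteq> 0"
  then have "u s \<in> filtration 1"
    using u_closed by (auto simp: filtration_def basis_elem_def)
  then show "u s \<in> jacobson_radical A"
    using filtration_subset_maximal u_closed by (auto simp: jacobson_radical_def)
next
  assume J: "u s \<in> jacobson_radical A"
  show "r s \<noteq> 0"
  proof
    assume r0: "r s = 0"
    interpret A: abelian_group A by (rule abelian_group_A)
    have "\<one>\<^bsub>A\<^esub> \<one>\<^bsub>G\<^esub> \<noteq> \<zero>\<^bsub>A\<^esub> \<one>\<^bsub>G\<^esub>"
      by (simp add: A_one A_zero basis_elem_def)
    then have "\<one>\<^bsub>A\<^esub> \<noteq> \<zero>\<^bsub>A\<^esub>"
      by auto
    moreover have "\<one>\<^bsub>A\<^esub> \<in> carrier A"
      by (simp add: A_one u_closed)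
    ultimately obtain M where M: "maximal_left_ideal M A"
      using A.exists_maximal_left_ideal A_mult_closed A_r_one A_r_distr by metis
    have "u (inv\<^bsub>G\<^esub> s) \<otimes>\<^bsub>A\<^esub> u s = \<one>\<^bsub>A\<^esub>"
      using u_mult[of "inv\<^bsub>G\<^esub> s" s] s r0 r_inv_zero r_one by (simp add: A_one)
    then have "\<one>\<^bsub>A\<^esub> \<in> M"
      using J M u_closed by (metis (no_types, lifting) jacobson_radical_def left_ideal_def
          maximal_left_ideal_def mem_Collect_eq)
    then show False
      using M left_ideal_eq_carrier[OF _ _ A_r_one] by (auto simp: maximal_left_ideal_def)
  qed
qed

section \<open>Subadditivity and zero set of the raised function\<close>

lemma raise_on_double_coset_Sl:
  assumes a: "a \<in> N1 L G e" and H: "H = zero_subgroup G r"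
  shows "raise_on_double_coset G H a r \<in> Sl G
    \<and> zero_subgroup G (raise_on_double_coset G H a r) = H"
proof -
  let ?D = "double_coset G H a"
  have aG: "a \<in> carrier G" and ra: "r a \<noteq> 0"
    and a2: "u a \<notin> ideal_prod A (jacobson_radical A) (jacobson_radical A)"
    using a u_in_radical_iff unfolding N1_def A_def[symmetric] Let_def by auto
  have D: "s \<in> ?D \<longleftrightarrow> (\<exists>h\<in>H. \<exists>k\<in>H. s = h \<otimes>\<^bsub>G\<^esub> a \<otimes>\<^bsub>G\<^esub> k)" for s
    by (auto simp: double_coset_def set_mult_def r_coset_def)
  have HG: "h \<in> carrier G" "r h = 0" if "h \<in> H" for h
    using that H by (auto simp: zero_subgroup_def)
  have HI: "h \<in> H" if "h \<in> carrier G" "r h = 0" for h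
    using that H by (auto simp: zero_subgroup_def)
  have rD: "r s = r a" if "s \<in> ?D" for s
    using that HG aG by (auto simp: D r_mult_zero_left r_mult_zero_right)
  have D_left: "h \<otimes>\<^bsub>G\<^esub> s \<in> ?D" if h: "h \<in> H" and s: "s \<in> ?D" for h s
  proof -
    obtain h' k where *: "h' \<in> H" "k \<in> H" "s = h' \<otimes>\<^bsub>G\<^esub> a \<otimes>\<^bsub>G\<^esub> k"
      using s D by auto
    then have "h \<otimes>\<^bsub>G\<^esub> s = (h \<otimes>\<^bsub>G\<^esub> h') \<otimes>\<^bsub>G\<^esub> a \<otimes>\<^bsub>G\<^esub> k"
      using HG h aG by (simp add: G.m_assoc)
    moreover have "h \<otimes>\<^bsub>G\<^esub> h' \<in> H"
      using HG h * by (intro HI) (auto simp: r_mult_zero_left)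
    ultimately show ?thesis
      using * D by blast
  qed
  have D_right: "s \<otimes>\<^bsub>G\<^esub> h \<in> ?D" if h: "h \<in> H" and s: "s \<in> ?D" for h s
  proof -
    obtain h' k where *: "h' \<in> H" "k \<in> H" "s = h' \<otimes>\<^bsub>G\<^esub> a \<otimes>\<^bsub>G\<^esub> k"
      using s D by auto
    then have "s \<otimes>\<^bsub>G\<^esub> h = h' \<otimes>\<^bsub>G\<^esub> a \<otimes>\<^bsub>G\<^esub> (k \<otimes>\<^bsub>G\<^esub> h)"
      using HG h aG by (simp add: G.m_assoc)
    moreover have "k \<otimes>\<^bsub>G\<^esub> h \<in> H"
      using HG h * by (intro HI) (auto simp: r_mult_zero_left)
    ultimately show ?thesis
      using * D by blast
  qed
  \<comment> \<open>Here \<open>u a\<close> lying outside the square of the radical is used;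
    strictness leaves room for the added 1.\<close>
  have indecomposable: "r (s \<otimes>\<^bsub>G\<^esub> t) < r s + r t"
    if st: "s \<in> carrier G" "t \<in> carrier G" "s \<otimes>\<^bsub>G\<^esub> t \<in> ?D" "r s \<noteq> 0" "r t \<noteq> 0" for s t
  proof (rule ccontr)
    assume "\<not> ?thesis"
    then have add: "r (s \<otimes>\<^bsub>G\<^esub> t) = r s + r t"
      using r_mult_le[OF st(1,2)] by simp
    obtain h k where hk: "h \<in> H" "k \<in> H" "s \<otimes>\<^bsub>G\<^esub> t = h \<otimes>\<^bsub>G\<^esub> a \<otimes>\<^bsub>G\<^esub> k"
      using st(3) D by auto
    \<comment> \<open>Absorbing \<open>h\<close> and \<open>k\<close> into the factors turns the
      factorization of \<open>h a k\<close> into one of \<open>a\<close>, with the same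
      \<open>r\<close>-values.\<close>
    let ?s = "inv\<^bsub>G\<^esub> h \<otimes>\<^bsub>G\<^esub> s" and ?t = "t \<otimes>\<^bsub>G\<^esub> inv\<^bsub>G\<^esub> k"
    have "?s \<otimes>\<^bsub>G\<^esub> ?t = inv\<^bsub>G\<^esub> h \<otimes>\<^bsub>G\<^esub> (s \<otimes>\<^bsub>G\<^esub> t) \<otimes>\<^bsub>G\<^esub> inv\<^bsub>G\<^esub> k"
      using st HG hk(1,2) by (simp add: G.m_assoc)
    also have "\<dots> = (inv\<^bsub>G\<^esub> h \<otimes>\<^bsub>G\<^esub> h) \<otimes>\<^bsub>G\<^esub> a \<otimes>\<^bsub>G\<^esub> (k \<otimes>\<^bsub>G\<^esub> inv\<^bsub>G\<^esub> k)"
      unfolding hk(3) using HG hk(1,2) aG by (simp only: G.m_assoc G.m_closed G.inv_closed)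
    also have "\<dots> = a"
      using HG hk(1,2) aG by simp
    finally have prod: "?s \<otimes>\<^bsub>G\<^esub> ?t = a" .
    have rs: "r ?s = r s" "r ?t = r t"
      using HG[OF hk(1)] HG[OF hk(2)] st by (auto simp: r_mult_zero_left r_mult_zero_right r_inv_zero)
    have sG: "?s \<in> carrier G" "?t \<in> carrier G"
      using HG hk st by auto
    have "u a = u ?s \<otimes>\<^bsub>A\<^esub> u ?t"
      using u_mult[OF sG] rs add rD[OF st(3)] prod by simp
    moreover have "u ?s \<in> jacobson_radical A" "u ?t \<in> jacobson_radical A"
      using rs st by (auto simp: u_in_radical_iff sG)
    ultimately show False
      using a2 ideal_prod.prod[of "u ?s" "jacobson_radical A" "u ?t" _ A] by simp
  qed
  have "raise_on_double_coset G H a r \<one>\<^bsub>G\<^esub> = 0"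
    \<comment> \<open>On \<open>?D\<close> the value of \<open>r\<close> is \<open>r a\<close>,
      which is nonzero, so the identity lies outside \<open>?D\<close>.\<close>
    using rD[of "\<one>\<^bsub>G\<^esub>"] ra r_one by (auto simp: raise_on_double_coset_def)
  moreover have "raise_on_double_coset G H a r (s \<otimes>\<^bsub>G\<^esub> t)
      \<le> raise_on_double_coset G H a r s + raise_on_double_coset G H a r t"
    if st: "s \<in> carrier G" "t \<in> carrier G" for s t
  proof -
    \<comment> \<open>If one factor is in \<open>H\<close>, the other is an
      \<open>H\<close>-translate of the product, hence in \<open>?D\<close>, and the right-hand side
      is raised too.\<close>
    have "s \<in> ?D \<or> t \<in> ?D" if D': "s \<otimes>\<^bsub>G\<^esub> t \<in> ?D" and r0: "r s = 0 \<or> r t = 0"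
      using r0
    proof
      assume "r s = 0"
      then have "inv\<^bsub>G\<^esub> s \<otimes>\<^bsub>G\<^esub> (s \<otimes>\<^bsub>G\<^esub> t) \<in> ?D"
        using D_left[OF HI D'] st r_inv_zero by simp
      then show ?thesis
        using st by (simp flip: G.m_assoc)
    next
      assume "r t = 0"
      then have "s \<otimes>\<^bsub>G\<^esub> t \<otimes>\<^bsub>G\<^esub> inv\<^bsub>G\<^esub> t \<in> ?D"
        using D_right[OF HI D'] st r_inv_zero by simp
      then show ?thesis
        using st by (simp add: G.m_assoc)
    qed
    then show ?thesis
      using indecomposable[OF st] r_mult_le[OF st]
      by (cases "s \<otimes>\<^bsub>G\<^esub> t \<in> ?D"; cases "r s = 0 \<or> r t = 0")
        (auto simp: raise_on_double_coset_def)
  qed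
  moreover have "zero_subgroup G (raise_on_double_coset G H a r) = H"
    using rD ra unfolding H by (auto simp: zero_subgroup_def raise_on_double_coset_def)
  ultimately show ?thesis
    by (simp add: Sl_def)
qed

end

section \<open>Specialization to the Galois group of \<open>L\<close> over \<open>K\<close>\<close>

theorem proposition2p2:
  fixes L :: "('a, 'b) ring_scheme" and R K :: "'a set"
    and G :: "('a \<Rightarrow> 'a) monoid" and r :: "('a \<Rightarrow> 'a) \<Rightarrow> nat"
    and e :: "('a \<Rightarrow> 'a) \<Rightarrow> ('a \<Rightarrow> 'a) \<Rightarrow> 'a" and H :: "('a \<Rightarrow> 'a) set" and a :: "'a \<Rightarrow> 'a"
  assumes "field L"
    and "subring R L"
    and "discrete_valuation_ring (L\<lparr>carrier := R\<rparr>)"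
    and "adically_complete (L\<lparr>carrier := R\<rparr>)"
    and "is_quotient_field L R K"
    and "finite_galois_extension L K"
    and "unramified L R"
    and "finite (carrier (residue_field (L\<lparr>carrier := R\<rparr>)))"
    and "G = Gal L K"
    and "r \<in> Sl G"
    and "e = idem_cocycle L G r"
    and "H = inertial_group L G e"
    and "a \<in> N1 L G e"
  shows "raise_on_double_coset G H a r \<in> Sl G
    \<and> zero_subgroup G (raise_on_double_coset G H a r) = H"
proof -
  interpret L: field L by fact
  have K: "subfield K L" and fd: "L.finite_dimension K (carrier L)"
    using \<open>finite_galois_extension L K\<close> by (auto simp: finite_galois_extension_def)
  have "group (Gal L K)"
    using L.group_Gal subfieldE(3)[OF K] by blast
  then interpret idem_crossed_product L G r
    using L.finite_Gal[OF K fd] Gal_carrierD(1)[of _ L K] \<open>r \<in> Sl G\<close> L.field_axioms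
    unfolding \<open>G = Gal L K\<close> idem_crossed_product_def idem_crossed_product_axioms_def by blast
  \<comment> \<open>The inertial group is exchanged for the zero set of \<open>r\<close>, the form
    in which \<open>raise_on_double_coset_Sl\<close> takes \<open>H\<close>.\<close>
  have "H = zero_subgroup G r" and "a \<in> N1 L G (idem_cocycle L G r)"
    using \<open>H = inertial_group L G e\<close> \<open>a \<in> N1 L G e\<close> inertial_group_eq
    unfolding \<open>e = idem_cocycle L G r\<close> by simp_all
  then show ?thesis
    using raise_on_double_coset_Sl by blast
qed

end
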